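(* Let $\mathbb{F}_q$ be a finite field and $n \ge 1$, and let $S, T$ be subsets of $\mathbb{F}_q^n$. Then there exist a subset $S' \subseteq S$ and a subset $T' \subseteq T$ such that (i) $|S'| + |T'| \leq M(\mathbb{F}_q^n)$, and (ii) $(S' + T) \cup (S + T') = S + T$.
   Context: For subsets $A, B \subseteq \mathbb{F}_q^n$, $A + B = \{a + b : a \in A, b \in B\}$. For a real number $d$, let $m_d$ denote the number of monomials $x_1^{a_1}\cdots x_n^{a_n}$ in the variables $x_1,\ldots,x_n$ with $0 \le a_i \le q-1$ for every $i$ and total degree $a_1+\cdots+a_n \le d$. Define $M(\mathbb{F}_q^n) = 3\, m_{(q-1)n/3}$. *)

theory Defs
  imports "HOL-Analysis.Finite_Cartesian_Product" "HOL-Library.Set_Algebras"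
begin

text \<open>
  A monomial in variables indexed by \<open>'n\<close> is represented by its exponent vector.
  The type argument \<open>'a ^ 'n\<close> stands for \<open>F_q^n\<close> with \<open>q = CARD('a)\<close> and \<open>n = CARD('n)\<close>.
\<close>

definition num_monomials :: "('a::{field,finite} ^ 'n::finite) itself \<Rightarrow> real \<Rightarrow> nat" where
  "num_monomials (F :: ('a ^ 'n) itself) d =
     card {a :: nat ^ 'n. (\<forall>i. a $ i \<le> CARD('a) - 1) \<and> real (\<Sum>i\<in>UNIV. a $ i) \<le> d}"

definition sumset_bound :: "('a::{field,finite} ^ 'n::finite) itself \<Rightarrow> nat" where
  "sumset_bound (F :: ('a ^ 'n) itself) =
     3 * num_monomials F ((real CARD('a) - 1) * real CARD('n) / 3)"

end

theory Submission
  imports Defs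
begin

text \<open>
  Let \<open>V\<close> be the space of polynomial functions of degree at most \<open>2(q - 1)n/3\<close> that vanish off
  \<open>S + T\<close>. By the Croot--Lev--Pach argument each matrix \<open>(f (s + t))\<close>, \<open>f \<in> V\<close>, has rank at most
  \<open>2 m\<close>, where \<open>m\<close> counts the monomials of degree at most \<open>(q - 1)n/3\<close>. Following Meshulam, consider
  the set \<open>E\<close> of lexicographically first nonzero positions of these matrices. A matching in \<open>E\<close> yields
  a sum of the corresponding matrices whose rank is at least the size of the matching, so by Koenig's
  theorem \<open>E\<close> is covered by at most \<open>2 m\<close> rows and columns. At most \<open>m\<close> points of \<open>S + T\<close> are not of the
  form \<open>s + t\<close> with \<open>(s, t) \<in> E\<close>: a larger set of points would support a nonzero function of \<open>V\<close>,
  since there are at most \<open>m\<close> monomials of degree exceeding \<open>2(q - 1)n/3\<close>, but the leading position of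
  that function would give one of its points. One further row takes care of each of these points.
\<close>

section \<open>Koenig's theorem\<close>

text \<open>Regard \<open>E\<close> as the edges of a bipartite graph and take a smallest
  counterexample. Each \<open>E - {e}\<close> has a cover of size at most \<open>k\<close>; if two
  edges share an end, uncrossing their two covers produces a cover of \<open>E\<close> of size at
  most \<open>k\<close>. Hence \<open>E\<close> is itself a matching, and its first ends cover
  it.\<close>

lemma koenig:
  assumes "finite E"
    and "\<And>M. M \<subseteq> E \<Longrightarrow> inj_on fst M \<Longrightarrow> inj_on snd M \<Longrightarrow> card M \<le> k"
  shows "\<exists>X Y. X \<subseteq> fst ` E \<and> Y \<subseteq> snd ` E \<and> card X + card Y \<le> k \<and> E \<subseteq> X \<times> UNIV \<union> UNIV \<times> Y"
  using assms
proof (induction "card E" arbitrary: E rule: less_induct)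
  case less
  define cov where "cov F X Y \<longleftrightarrow> X \<subseteq> fst ` E \<and> Y \<subseteq> snd ` E \<and> (\<forall>g\<in>F. fst g \<in> X \<or> snd g \<in> Y)"
    for F X Y
  have fin: "finite X" "finite Y" if "cov F X Y" for F X Y
    using that less.prems(1) finite_subset unfolding cov_def by blast+
  have crit: "\<exists>X Y. cov (E - {e}) X Y \<and> card X + card Y \<le> k" if "e \<in> E" for e
  proof -
    have "\<exists>X Y. X \<subseteq> fst ` (E - {e}) \<and> Y \<subseteq> snd ` (E - {e}) \<and> card X + card Y \<le> k \<and>
             E - {e} \<subseteq> X \<times> UNIV \<union> UNIV \<times> Y"
    proof (rule less.hyps)
      show "card (E - {e}) < card E"
        using less.prems(1) that by (rule card_Diff1_less)
    qed (use less.prems in auto)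
    then obtain X Y where XY: "X \<subseteq> fst ` (E - {e})" "Y \<subseteq> snd ` (E - {e})" "card X + card Y \<le> k"
        "E - {e} \<subseteq> X \<times> UNIV \<union> UNIV \<times> Y" by blast
    have "cov (E - {e}) X Y" unfolding cov_def using XY(1,2,4) by fastforce
    then show ?thesis using XY(3) by blast
  qed
  show ?case
  proof (rule ccontr)
    assume "\<not> ?case"
    have large: "k < card X + card Y" if "cov E X Y" for X Y
    proof (rule ccontr)
      assume "\<not> k < card X + card Y"
      moreover have "E \<subseteq> X \<times> UNIV \<union> UNIV \<times> Y"
        using that unfolding cov_def by (auto simp: mem_Times_iff)
      ultimately show False using \<open>\<not> ?case\<close> that unfolding cov_def by (meson not_le)
    qed
    \<comment> \<open>The crossed pairs \<open>(A \<union> C, B \<inter> D)\<close> and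
      \<open>(A \<inter> C, B \<union> D)\<close> have the same total size as the two covers, so
      they cannot have sizes at least \<open>k\<close> and more than \<open>k\<close>.\<close>
    have submod: "card (A \<union> C) + card (A \<inter> C) + (card (B \<inter> D) + card (B \<union> D)) \<le> 2 * k"
      if "cov F A B" "cov G C D" "card A + card B \<le> k" "card C + card D \<le> k" for F G A B C D
      using that card_Un_Int[of A C] card_Un_Int[of B D] fin[OF that(1)] fin[OF that(2)] by linarith
    have "inj_on fst E"
    proof (rule inj_onI, rule ccontr)
      fix e f assume ef: "e \<in> E" "f \<in> E" "fst e = fst f" "e \<noteq> f"
      obtain A B where AB: "cov (E - {e}) A B" "card A + card B \<le> k" using crit ef by blast
      obtain C D where CD: "cov (E - {f}) C D" "card C + card D \<le> k" using crit ef by blast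
      have not_cov: "\<not> cov E A B" "\<not> cov E C D" using large AB(2) CD(2) by (meson not_le)+
      \<comment> \<open>The first crossed pair covers all edges other than \<open>e\<close> and
        \<open>f\<close>; one more vertex, their common end, covers these two.\<close>
      have "cov E (insert (fst e) (A \<union> C)) (B \<inter> D)"
        using AB(1) CD(1) ef unfolding cov_def by auto
      then have "k < card (insert (fst e) (A \<union> C)) + card (B \<inter> D)" by (rule large)
      also have "\<dots> \<le> Suc (card (A \<union> C)) + card (B \<inter> D)" by (simp add: card_insert_le_m1 card_insert_if fin[OF AB(1)] fin[OF CD(1)])
      finally have 1: "k \<le> card (A \<union> C) + card (B \<inter> D)" by simp
      \<comment> \<open>\<open>(C, D)\<close> misses \<open>f\<close>, so the common end is not in
        \<open>C\<close> and \<open>e\<close> must be covered through \<open>D\<close>; likewise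
        \<open>f\<close> through \<open>B\<close>. The second crossed pair therefore covers
        \<open>E\<close> with no addition.\<close>
      have "snd e \<in> D" "snd f \<in> B"
        using AB(1) CD(1) not_cov ef unfolding cov_def by (metis Diff_iff singletonD)+
      then have "cov E (A \<inter> C) (B \<union> D)"
        using AB(1) CD(1) ef unfolding cov_def by auto
      then have "k < card (A \<inter> C) + card (B \<union> D)" by (rule large)
      with 1 submod[OF AB(1) CD(1) AB(2) CD(2)] show False by linarith
    qed
    \<comment> \<open>The same argument with the two sides exchanged.\<close>
    moreover have "inj_on snd E"
    proof (rule inj_onI, rule ccontr)
      fix e f assume ef: "e \<in> E" "f \<in> E" "snd e = snd f" "e \<noteq> f"
      obtain A B where AB: "cov (E - {e}) A B" "card A + card B \<le> k" using crit ef by blast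
      obtain C D where CD: "cov (E - {f}) C D" "card C + card D \<le> k" using crit ef by blast
      have not_cov: "\<not> cov E A B" "\<not> cov E C D" using large AB(2) CD(2) by (meson not_le)+
      have "cov E (A \<inter> C) (insert (snd e) (B \<union> D))"
        using AB(1) CD(1) ef unfolding cov_def by auto
      then have "k < card (A \<inter> C) + card (insert (snd e) (B \<union> D))" by (rule large)
      also have "\<dots> \<le> card (A \<inter> C) + Suc (card (B \<union> D))" by (simp add: card_insert_if fin[OF AB(1)] fin[OF CD(1)])
      finally have 1: "k \<le> card (A \<inter> C) + card (B \<union> D)" by simp
      have "fst e \<in> C" "fst f \<in> A"
        using AB(1) CD(1) not_cov ef unfolding cov_def by (metis Diff_iff singletonD)+
      then have "cov E (A \<union> C) (B \<inter> D)"
        using AB(1) CD(1) ef unfolding cov_def by auto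
      then have "k < card (A \<union> C) + card (B \<inter> D)" by (rule large)
      with 1 submod[OF AB(1) CD(1) AB(2) CD(2)] show False by linarith
    qed
    ultimately have "card (fst ` E) \<le> k" using less.prems(2)[of E] by (simp add: card_image)
    moreover have "cov E (fst ` E) {}" unfolding cov_def by (auto intro: rev_image_eqI)
    ultimately show False using large by fastforce
  qed
qed

section \<open>Matrices of bounded rank\<close>

text \<open>Pigeonhole over a finite field: the linear map \<open>\<Phi>\<close> has more arguments
  than possible values, and the difference of two arguments with equal image is a solution.\<close>

lemma exists_nontrivial_solution:
  fixes c :: "'w \<Rightarrow> 'j \<Rightarrow> 'a::{field,finite}"
  assumes "finite W" "finite J" "card J < card W"
  shows "\<exists>f. (\<exists>w\<in>W. f w \<noteq> 0) \<and> (\<forall>j\<in>J. (\<Sum>w\<in>W. f w * c w j) = 0)"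
proof -
  define \<Phi> where "\<Phi> f = (\<lambda>j\<in>J. \<Sum>w\<in>W. f w * c w j)" for f
  have "Suc 0 < CARD('a)"
    using card_mono[of UNIV "{0, 1 :: 'a}"] by simp
  then have "card (PiE J (\<lambda>_. UNIV :: 'a set)) < card (PiE W (\<lambda>_. UNIV :: 'a set))"
    using assms by (simp add: card_PiE)
  moreover have "\<Phi> ` PiE W (\<lambda>_. UNIV) \<subseteq> PiE J (\<lambda>_. UNIV)" unfolding \<Phi>_def by auto
  ultimately have "\<not> inj_on \<Phi> (PiE W (\<lambda>_. UNIV))"
    by (meson card_inj_on_le finite_PiE assms finite_code not_le)
  then obtain f g where fg: "f \<in> PiE W (\<lambda>_. UNIV)" "g \<in> PiE W (\<lambda>_. UNIV)" "\<Phi> f = \<Phi> g" "f \<noteq> g"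
    unfolding inj_on_def by blast
  then have "\<exists>w\<in>W. f w - g w \<noteq> 0" by (metis PiE_ext eq_iff_diff_eq_0)
  moreover have "(\<Sum>w\<in>W. (f w - g w) * c w j) = 0" if "j \<in> J" for j
    using fun_cong[OF fg(3), of j] that unfolding \<Phi>_def by (simp add: left_diff_distrib sum_subtractf)
  ultimately show ?thesis by (intro exI[of _ "\<lambda>w. f w - g w"]) auto
qed

text \<open>Independence of an indexed family, not of a set: equal rows at two indices are
  dependent.\<close>

definition indep_rows :: "'i set \<Rightarrow> 'c set \<Rightarrow> ('i \<Rightarrow> 'c \<Rightarrow> 'a::field) \<Rightarrow> bool" where
  "indep_rows I T R \<longleftrightarrow>
     (\<forall>c. (\<forall>t\<in>T. (\<Sum>i\<in>I. c i * R i t) = 0) \<longrightarrow> (\<forall>i\<in>I. c i = 0))"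

lemma indep_rows_cong:
  assumes "\<And>i t. i \<in> I \<Longrightarrow> t \<in> T \<Longrightarrow> R i t = R' i t"
  shows "indep_rows I T R \<longleftrightarrow> indep_rows I T R'"
  unfolding indep_rows_def using assms by (auto cong: sum.cong ball_cong)

text \<open>A factorisation into \<open>card L\<close> products bounds the rank: coefficients
  annihilating every \<open>u l\<close> annihilate the rows.\<close>

lemma indep_rows_card_le:
  fixes R :: "'i \<Rightarrow> 'c \<Rightarrow> 'a::{field,finite}"
  assumes "finite I" "finite L" "indep_rows I T R"
    and "\<And>i t. i \<in> I \<Longrightarrow> t \<in> T \<Longrightarrow> R i t = (\<Sum>l\<in>L. u l i * v l t)"
  shows "card I \<le> card L"
proof (rule ccontr)
  assume "\<not> card I \<le> card L"
  then obtain c where c: "\<exists>i\<in>I. c i \<noteq> 0" "\<And>l. l \<in> L \<Longrightarrow> (\<Sum>i\<in>I. c i * u l i) = 0"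
    using exists_nontrivial_solution[of I L "\<lambda>i l. u l i"] assms(1,2) by auto
  have "(\<Sum>i\<in>I. c i * R i t) = 0" if "t \<in> T" for t
  proof -
    have "(\<Sum>i\<in>I. c i * R i t) = (\<Sum>i\<in>I. \<Sum>l\<in>L. c i * u l i * v l t)"
      using that assms(4) by (simp add: sum_distrib_left mult.assoc)
    also have "\<dots> = (\<Sum>l\<in>L. (\<Sum>i\<in>I. c i * u l i) * v l t)"
      by (subst sum.swap) (simp add: sum_distrib_right)
    finally show ?thesis using c(2) by simp
  qed
  then show False using assms(3) c(1) unfolding indep_rows_def by blast
qed

text \<open>If both new rows were combinations of the other rows, then so would be their difference \<open>R b\<close>.\<close>

lemma indep_rows_replace:
  assumes "finite I" "b \<in> I" "indep_rows I T R"
  shows "indep_rows I T (R(b := w)) \<or> indep_rows I T (R(b := (\<lambda>t. w t + R b t)))"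
proof (rule ccontr)
  assume neg: "\<not> ?thesis"
  let ?I = "I - {b}"
  have split: "(\<Sum>i\<in>I. c i * (R(b := z)) i t) = c b * z t + (\<Sum>i\<in>?I. c i * R i t)" for c z t
    by (subst sum.remove[OF assms(1,2)]) (auto intro!: sum.cong)
  have split': "(\<Sum>i\<in>I. c i * R i t) = c b * R b t + (\<Sum>i\<in>?I. c i * R i t)" for c t
    by (rule sum.remove[OF assms(1,2)])
  \<comment> \<open>A dependency of the changed family has a nonzero coefficient at
    \<open>b\<close>, since the remaining rows are independent; dividing by it expresses
    \<open>z\<close> through them.\<close>
  have span: "\<exists>c. \<forall>t\<in>T. z t = (\<Sum>i\<in>?I. c i * R i t)" if dep: "\<not> indep_rows I T (R(b := z))" for z
  proof -
    obtain c where c: "\<And>t. t \<in> T \<Longrightarrow> c b * z t + (\<Sum>i\<in>?I. c i * R i t) = 0" "\<exists>i\<in>I. c i \<noteq> 0"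
      using dep unfolding indep_rows_def split by blast
    have "c b \<noteq> 0"
    proof
      assume "c b = 0"
      then have "\<forall>t\<in>T. (\<Sum>i\<in>I. c i * R i t) = 0" using c(1) split'[of c] by simp
      then show False using c(2) assms(3) unfolding indep_rows_def by blast
    qed
    then have "z t = (\<Sum>i\<in>?I. (- c i / c b) * R i t)" if "t \<in> T" for t
    proof -
      have "(\<Sum>i\<in>?I. (- c i / c b) * R i t) = - (\<Sum>i\<in>?I. c i * R i t) / c b"
        by (simp add: sum_negf sum_divide_distrib)
      also have "(\<Sum>i\<in>?I. c i * R i t) = - (c b * z t)"
        using c(1)[OF that] by (simp add: eq_neg_iff_add_eq_0 add.commute)
      finally show ?thesis using \<open>c b \<noteq> 0\<close> by simp
    qed
    then show ?thesis by (intro exI[of _ "\<lambda>i. - c i / c b"]) blast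
  qed
  obtain c where c: "\<And>t. t \<in> T \<Longrightarrow> w t = (\<Sum>i\<in>?I. c i * R i t)" using span neg by blast
  obtain d where d: "\<And>t. t \<in> T \<Longrightarrow> w t + R b t = (\<Sum>i\<in>?I. d i * R i t)"
    using span[of "\<lambda>t. w t + R b t"] neg by blast
  define e where "e = (\<lambda>i. d i - c i)(b := -1)"
  have "(\<Sum>i\<in>I. e i * R i t) = 0" if "t \<in> T" for t
  proof -
    have "(\<Sum>i\<in>?I. e i * R i t) = (\<Sum>i\<in>?I. d i * R i t - c i * R i t)"
      by (rule sum.cong) (auto simp: e_def algebra_simps)
    also have "\<dots> = R b t" unfolding sum_subtractf using c[OF that] d[OF that] by (metis add_diff_cancel_left')
    finally show ?thesis using split'[of e] by (simp add: e_def)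
  qed
  then have "e b = 0" using assms(2,3) unfolding indep_rows_def by blast
  then show False by (simp add: e_def)
qed

text \<open>Start from the family whose row \<open>i\<close> is row \<open>i\<close> of \<open>B i\<close>: it is in echelon form up to a
  permutation. Then, in the order of \<open>\<rho>\<close>, turn its rows into rows of one sum of matrices, deciding at
  row \<open>b\<close> whether \<open>B b\<close> joins the sum; this does not affect earlier rows, where \<open>B b\<close> vanishes.\<close>

lemma indep_rows_of_leading_positions:
  fixes \<rho> \<kappa> :: "_ \<Rightarrow> nat"
  assumes "finite I" "inj_on \<rho> I" "inj_on p I" "inj_on \<kappa> T" "p ` I \<subseteq> T"
    and nz: "\<And>i. i \<in> I \<Longrightarrow> B i i (p i) \<noteq> 0"
    and row: "\<And>i j t. i \<in> I \<Longrightarrow> j \<in> I \<Longrightarrow> t \<in> T \<Longrightarrow> \<rho> j < \<rho> i \<Longrightarrow> B i j t = 0"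
    and col: "\<And>i t. i \<in> I \<Longrightarrow> t \<in> T \<Longrightarrow> \<kappa> t < \<kappa> (p i) \<Longrightarrow> B i i t = 0"
  shows "\<exists>X\<subseteq>I. indep_rows I T (\<lambda>i t. \<Sum>j\<in>X. B j i t)"
proof -
  \<comment> \<open>\<open>R\<close> interpolates between the echelon family, at
    \<open>H = {}\<close>, and the rows of a single sum of matrices, at
    \<open>H = I\<close>.\<close>
  define R where "R H X i t = (if i \<in> H then \<Sum>j\<in>X. B j i t else B i i t)" for H X i t
  have base: "indep_rows I T (\<lambda>i. B i i)"
    unfolding indep_rows_def
  proof (intro allI impI, rule ccontr)
    fix c assume c: "\<forall>t\<in>T. (\<Sum>i\<in>I. c i * B i i t) = 0" and "\<not> (\<forall>i\<in>I. c i = 0)"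
    then obtain i0 where "i0 \<in> I \<and> c i0 \<noteq> 0" by blast
    \<comment> \<open>Take the leftmost pivot among the rows with nonzero coefficient: all the other
      such rows vanish in its column.\<close>
    from ex_has_least_nat[of "\<lambda>i. i \<in> I \<and> c i \<noteq> 0", OF this, of "\<lambda>i. \<kappa> (p i)"]
    obtain i where i: "i \<in> I" "c i \<noteq> 0" "\<And>j. j \<in> I \<Longrightarrow> c j \<noteq> 0 \<Longrightarrow> \<kappa> (p i) \<le> \<kappa> (p j)" by blast
    have "c j * B j j (p i) = 0" if "j \<in> I - {i}" for j
    proof (cases "c j = 0")
      case False
      have "\<kappa> (p i) \<noteq> \<kappa> (p j)" using that i(1) assms(3-5)
        by (metis DiffE image_subset_iff inj_on_eq_iff singletonI)
      then show ?thesis using i(1,3) that False col assms(5) by (simp add: order_less_le image_subset_iff)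
    qed simp
    then have "(\<Sum>j\<in>I - {i}. c j * B j j (p i)) = 0" by (intro sum.neutral ballI)
    then have "(\<Sum>j\<in>I. c j * B j j (p i)) = c i * B i i (p i)"
      by (simp add: sum.remove[OF assms(1) i(1)])
    then show False using c i(1,2) nz assms(5) by fastforce
  qed
  have "\<exists>X\<subseteq>H. indep_rows I T (R H X)" if "H \<subseteq> I" for H
    using finite_subset[OF that assms(1)] that
  \<comment> \<open>Rows are inserted in order of \<open>\<rho>\<close>, so every row already in
    \<open>H\<close> lies weakly before \<open>b\<close>.\<close>
  proof (induction H rule: finite_ranking_induct[where f = \<rho>])
    case empty
    then show ?case using base by (intro exI[of _ "{}"]) (simp add: R_def)
  next
    case (insert b H)
    then obtain X where X: "X \<subseteq> H" "indep_rows I T (R H X)" by auto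
    show ?case
    proof (cases "b \<in> H")
      case True
      then show ?thesis using X by (auto simp: insert_absorb)
    next
      case False
      have fX: "finite X" "b \<notin> X" using X(1) False insert.hyps finite_subset by auto
      have below: "B b j t = 0" if "j \<in> H" "t \<in> T" for j t
      proof (rule row)
        have "\<rho> j \<noteq> \<rho> b" using that False insert.prems assms(2) by (auto dest!: inj_onD)
        then show "\<rho> j < \<rho> b" using insert.hyps(2)[OF that(1)] by simp
      qed (use that insert.prems in auto)
      \<comment> \<open>Row \<open>b\<close> is still \<open>B b b\<close> here, so the two
        alternatives are row \<open>b\<close> of the sum over \<open>X\<close> and of the sum over
        \<open>insert b X\<close>.\<close>
      have "indep_rows I T ((R H X)(b := (\<lambda>t. \<Sum>j\<in>X. B j b t))) \<or>
            indep_rows I T ((R H X)(b := (\<lambda>t. (\<Sum>j\<in>X. B j b t) + R H X b t)))"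
        using insert.prems by (intro indep_rows_replace assms X(2)) auto
      moreover have "(R H X)(b := (\<lambda>t. \<Sum>j\<in>X. B j b t)) = R (insert b H) X"
        using False by (auto simp: R_def fun_eq_iff)
      moreover have "indep_rows I T ((R H X)(b := (\<lambda>t. (\<Sum>j\<in>X. B j b t) + R H X b t))) \<longleftrightarrow>
          indep_rows I T (R (insert b H) (insert b X))"
        using False fX below by (intro indep_rows_cong) (auto simp: R_def add.commute)
      ultimately show ?thesis using X(1) by (metis insert_mono subset_insertI2)
    qed
  qed
  from this[of I] obtain X where "X \<subseteq> I" "indep_rows I T (R I X)" by auto
  moreover have "indep_rows I T (R I X) \<longleftrightarrow> indep_rows I T (\<lambda>i t. \<Sum>j\<in>X. B j i t)"
    by (rule indep_rows_cong) (simp add: R_def)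
  ultimately show ?thesis by blast
qed

section \<open>Reduced polynomials\<close>

text \<open>For \<open>m = CARD('a) - 1\<close> these are the exponents of reduced monomials, which
  suffice to represent all functions.\<close>

definition exps :: "nat \<Rightarrow> nat \<Rightarrow> (nat ^ 'n::finite) set" where
  "exps m D = {a. (\<forall>i. a $ i \<le> m) \<and> (\<Sum>i\<in>UNIV. a $ i) \<le> D}"

definition mon :: "nat ^ 'n::finite \<Rightarrow> 'a::field ^ 'n \<Rightarrow> 'a" where
  "mon a x = (\<Prod>i\<in>UNIV. x $ i ^ a $ i)"

definition low_degree :: "nat \<Rightarrow> nat \<Rightarrow> ('a::field ^ 'n::finite \<Rightarrow> 'a) \<Rightarrow> bool" where
  "low_degree m D f \<longleftrightarrow> (\<exists>C. \<forall>x. f x = (\<Sum>a\<in>exps m D. C a * mon a x))"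

lemma finite_bounded_exps: "finite {a :: nat ^ 'n::finite. \<forall>i. a $ i \<le> N i}"
proof -
  have "{a :: nat ^ 'n. \<forall>i. a $ i \<le> N i} \<subseteq> vec_lambda ` (PiE UNIV (\<lambda>i. {..N i}))"
  proof
    fix a :: "nat ^ 'n" assume "a \<in> {a. \<forall>i. a $ i \<le> N i}"
    then show "a \<in> vec_lambda ` (PiE UNIV (\<lambda>i. {..N i}))"
      by (intro image_eqI[of _ _ "vec_nth a"]) (auto simp: vec_nth_inverse)
  qed
  then show ?thesis by (rule finite_subset) (intro finite_imageI finite_PiE, auto)
qed

lemma finite_exps [simp]: "finite (exps m D)"
  unfolding exps_def by (rule finite_subset[OF _ finite_bounded_exps[of "\<lambda>_. m"]]) auto

text \<open>Serves twice: for the binomial expansion of \<open>mon a (s + t)\<close> and for the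
  expansion of a point indicator.\<close>

lemma prod_sum_vec:
  fixes g :: "'n::finite \<Rightarrow> nat \<Rightarrow> 'a::comm_semiring_1"
  shows "(\<Prod>i\<in>UNIV. \<Sum>j\<le>N i. g i j) = (\<Sum>a\<in>{a :: nat ^ 'n. \<forall>i. a $ i \<le> N i}. \<Prod>i\<in>UNIV. g i (a $ i))"
proof -
  have "(\<Prod>i\<in>UNIV. \<Sum>j\<le>N i. g i j) = (\<Sum>h\<in>PiE UNIV (\<lambda>i. {..N i}). \<Prod>i\<in>UNIV. g i (h i))"
    by (rule prod_sum_PiE) auto
  also have "\<dots> = (\<Sum>a\<in>{a :: nat ^ 'n. \<forall>i. a $ i \<le> N i}. \<Prod>i\<in>UNIV. g i (a $ i))"
    by (rule sum.reindex_bij_witness[of _ vec_nth vec_lambda]) (auto simp: vec_nth_inverse)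
  finally show ?thesis .
qed

lemma low_degree_sum:
  assumes "\<And>j. j \<in> X \<Longrightarrow> low_degree m D (f j)"
  shows "low_degree m D (\<lambda>x. \<Sum>j\<in>X. f j x)"
proof -
  obtain C where C: "\<And>j x. j \<in> X \<Longrightarrow> f j x = (\<Sum>a\<in>exps m D. C j a * mon a x)"
    using assms unfolding low_degree_def by metis
  have "(\<Sum>j\<in>X. f j x) = (\<Sum>a\<in>exps m D. (\<Sum>j\<in>X. C j a) * mon a x)" for x
    by (simp add: C sum_distrib_right sum.swap[of _ X])
  then show ?thesis unfolding low_degree_def by (intro exI allI)
qed

text \<open>The Croot--Lev--Pach splitting: in each monomial of \<open>f (s + t)\<close> one of the factors in \<open>s\<close>
  and in \<open>t\<close> has at most half the degree.\<close>

lemma low_degree_splitting: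
  fixes f :: "'a::field ^ 'n::finite \<Rightarrow> 'a"
  assumes "low_degree m D f" "D \<le> 2 * e + 1"
  shows "\<exists>u v. \<forall>s t. f (s + t) =
    (\<Sum>l\<in>(exps m e :: (nat ^ 'n) set) <+> (exps m e :: (nat ^ 'n) set). u l s * v l t)"
proof -
  let ?E = "exps m e :: (nat ^ 'n) set"
  obtain C where C: "\<And>x. f x = (\<Sum>a\<in>exps m D. C a * mon a x)"
    using assms(1) unfolding low_degree_def by blast
  \<comment> \<open>\<open>P\<close> indexes the terms of the binomial expansion: \<open>b\<close>
    is the exponent of \<open>s\<close>, and \<open>rest a b\<close> that of
    \<open>t\<close>.\<close>
  define P where "P = (SIGMA a : exps m D. {b :: nat ^ 'n. \<forall>i. b $ i \<le> a $ i})"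
  define K where "K a b = C a * (\<Prod>i\<in>UNIV. of_nat (a $ i choose b $ i))" for a b :: "nat ^ 'n"
  define rest where "rest a b = (\<chi> i. a $ i - b $ i)" for a b :: "nat ^ 'n"
  have finP: "finite P" unfolding P_def by (intro finite_SigmaI finite_exps finite_bounded_exps)
  have mon_add: "mon a (s + t) = (\<Sum>b\<in>{b. \<forall>i. b $ i \<le> a $ i}.
      (\<Prod>i\<in>UNIV. of_nat (a $ i choose b $ i)) * mon b s * mon (rest a b) t)" for a s and t :: "'a ^ 'n"
    by (simp add: mon_def binomial_ring prod_sum_vec prod.distrib rest_def)
  have f_add: "f (s + t) = (\<Sum>(a, b)\<in>P. K a b * mon b s * mon (rest a b) t)" for s t
    unfolding P_def by (subst sum.Sigma[symmetric])
      (auto simp: finite_bounded_exps C mon_add K_def sum_distrib_left mult.assoc)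
  define P1 where "P1 = {(a, b) \<in> P. b \<in> ?E}"
  define P2 where "P2 = {(a, b) \<in> P. b \<notin> ?E}"
  have split: "P = P1 \<union> P2" "P1 \<inter> P2 = {}" "finite P1" "finite P2"
    using finP unfolding P1_def P2_def by (auto intro: finite_subset[of _ P])
  have P1: "snd ` P1 \<subseteq> ?E" unfolding P1_def by auto
  have P2: "(\<lambda>(a, b). rest a b) ` P2 \<subseteq> ?E"
  proof clarify
    fix a b assume "(a, b) \<in> P2"
    then have ab: "\<And>i. a $ i \<le> m" "(\<Sum>i\<in>UNIV. a $ i) \<le> D" "\<And>i. b $ i \<le> a $ i" "b \<notin> ?E"
      unfolding P2_def P_def exps_def by auto
    have "b $ i \<le> m" for i using ab(1,3) order_trans by blast
    \<comment> \<open>The part in \<open>s\<close> has degree at least \<open>e + 1\<close>, leaving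
      at most \<open>D - (e + 1)\<close>, hence at most \<open>e\<close>, for the part in
      \<open>t\<close>.\<close>
    then have "e < (\<Sum>i\<in>UNIV. b $ i)" using ab(4) unfolding exps_def by auto
    moreover have "(\<Sum>i\<in>UNIV. b $ i) + (\<Sum>i\<in>UNIV. rest a b $ i) = (\<Sum>i\<in>UNIV. a $ i)"
      by (simp add: rest_def ab(3) flip: sum.distrib)
    ultimately have "(\<Sum>i\<in>UNIV. rest a b $ i) \<le> e" using ab(2) assms(2) by linarith
    then show "rest a b \<in> ?E"
      using ab(1) unfolding exps_def by (auto simp: rest_def intro: le_trans[OF diff_le_self])
  qed
  \<comment> \<open>Terms of \<open>P1\<close> are grouped by their monomial in \<open>s\<close>
    (left summand), terms of \<open>P2\<close> by their monomial in \<open>t\<close> (right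
    summand).\<close>
  define u where "u = case_sum (\<lambda>b s. mon b s)
    (\<lambda>c s. \<Sum>(a, b)\<in>{z \<in> P2. (\<lambda>(a, b). rest a b) z = c}. K a b * mon b s)"
  define v where "v = case_sum
    (\<lambda>c t. \<Sum>(a, b)\<in>{z \<in> P1. snd z = c}. K a b * mon (rest a b) t) (\<lambda>c t. mon c t)"
  have "f (s + t) = (\<Sum>l\<in>?E <+> ?E. u l s * v l t)" for s t
  proof -
    let ?h = "\<lambda>(a, b). K a b * mon b s * mon (rest a b) t"
    have "sum ?h P1 = (\<Sum>c\<in>?E. sum ?h {z \<in> P1. snd z = c})"
      by (rule sum.group[OF split(3) finite_exps P1, symmetric])
    also have "\<dots> = (\<Sum>c\<in>?E. u (Inl c) s * v (Inl c) t)"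
      by (intro sum.cong refl) (auto simp: u_def v_def sum_distrib_left mult_ac intro!: sum.cong)
    finally have h1: "sum ?h P1 = (\<Sum>c\<in>?E. u (Inl c) s * v (Inl c) t)" .
    have "sum ?h P2 = (\<Sum>c\<in>?E. sum ?h {z \<in> P2. (\<lambda>(a, b). rest a b) z = c})"
      by (rule sum.group[OF split(4) finite_exps P2, symmetric])
    also have "\<dots> = (\<Sum>c\<in>?E. u (Inr c) s * v (Inr c) t)"
      by (intro sum.cong refl) (auto simp: u_def v_def sum_distrib_right intro!: sum.cong)
    finally have h2: "sum ?h P2 = (\<Sum>c\<in>?E. u (Inr c) s * v (Inr c) t)" .
    have "f (s + t) = sum ?h P1 + sum ?h P2"
      unfolding f_add split(1) by (rule sum.union_disjoint) (use split in auto)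
    then show ?thesis using h1 h2 by (simp add: sum.Plus)
  qed
  then show ?thesis by blast
qed

section \<open>Point indicators and low-degree functions with prescribed support\<close>

lemma finite_field_power_eq_1:
  fixes x :: "'a::{field,finite}"
  assumes "x \<noteq> 0"
  shows "x ^ (CARD('a) - 1) = 1"
proof -
  let ?U = "UNIV - {0 :: 'a}"
  have "(\<Prod>y\<in>?U. y) = (\<Prod>y\<in>?U. x * y)"
    by (rule prod.reindex_bij_witness[of _ "\<lambda>y. x * y" "\<lambda>y. y / x"]) (use assms in auto)
  also have "\<dots> = x ^ card ?U * (\<Prod>y\<in>?U. y)" by (simp add: prod.distrib)
  finally have "x ^ card ?U = 1" by (simp add: prod_zero_iff)
  then show ?thesis by (simp add: card_Diff_singleton)
qed

text \<open>With \<open>q = CARD('a)\<close>, the indicator of \<open>w\<close> is the product over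
  \<open>i\<close> of \<open>1 - (x $ i - w $ i) ^ (q - 1)\<close>, which has degree at most
  \<open>q - 1\<close> in each variable.\<close>

lemma delta_expansion:
  fixes w :: "'a::{field,finite} ^ 'n::finite"
  shows "\<exists>c. \<forall>x. (if x = w then 1 else 0) =
    (\<Sum>a\<in>{a :: nat ^ 'n. \<forall>i. a $ i \<le> CARD('a) - 1}. c a * mon a x)"
proof -
  let ?m = "CARD('a) - 1"
  \<comment> \<open>\<open>g i j\<close> is the coefficient of \<open>x ^ j\<close> in the factor
    for coordinate \<open>i\<close>.\<close>
  define g where "g i j = (if j = 0 then 1 else 0) - of_nat (?m choose j) * (- w $ i) ^ (?m - j)"
    for i j
  have "0 < ?m" using card_mono[of UNIV "{0, 1 :: 'a}"] by simp
  have "(\<Sum>j\<le>?m. g i j * x ^ j) = (if x = w $ i then 1 else 0)" for i x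
  proof -
    have "(\<Sum>j\<le>?m. g i j * x ^ j) =
        (\<Sum>j\<le>?m. if j = 0 then 1 else 0) - (\<Sum>j\<le>?m. of_nat (?m choose j) * x ^ j * (- w $ i) ^ (?m - j))"
      unfolding sum_subtractf[symmetric] by (rule sum.cong) (auto simp: g_def algebra_simps)
    also have "\<dots> = 1 - (x + (- w $ i)) ^ ?m" unfolding binomial_ring by simp
    also have "\<dots> = (if x = w $ i then 1 else 0)"
      using finite_field_power_eq_1[of "x - w $ i"] \<open>0 < ?m\<close> by simp
    finally show ?thesis .
  qed
  then have "(if x = w then 1 else 0) = (\<Prod>i\<in>UNIV. \<Sum>j\<le>?m. g i j * x $ i ^ j)" for x
    by (auto simp: vec_eq_iff)
  also have "\<dots> x = (\<Sum>a\<in>{a :: nat ^ 'n. \<forall>i. a $ i \<le> ?m}. (\<Prod>i\<in>UNIV. g i (a $ i)) * mon a x)" for x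
    by (simp add: prod_sum_vec prod.distrib mon_def)
  finally show ?thesis by (intro exI allI)
qed

text \<open>Dimension count: a combination of the indicators of the points of \<open>W\<close> has
  \<open>card W\<close> free coefficients, and each exponent of degree above \<open>D\<close>
  imposes one linear condition.\<close>

lemma exists_low_degree_supported:
  fixes W :: "('a::{field,finite} ^ 'n::finite) set"
  assumes "card {a :: nat ^ 'n. (\<forall>i. a $ i \<le> CARD('a) - 1) \<and> D < (\<Sum>i\<in>UNIV. a $ i)} < card W"
  shows "\<exists>f. low_degree (CARD('a) - 1) D f \<and> (\<exists>x. f x \<noteq> 0) \<and> (\<forall>x. x \<notin> W \<longrightarrow> f x = 0)"
proof -
  let ?A = "{a :: nat ^ 'n. \<forall>i. a $ i \<le> CARD('a) - 1}"
  let ?H = "{a :: nat ^ 'n. (\<forall>i. a $ i \<le> CARD('a) - 1) \<and> D < (\<Sum>i\<in>UNIV. a $ i)}"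
  let ?L = "exps (CARD('a) - 1) D :: (nat ^ 'n) set"
  have "\<forall>w. \<exists>c. \<forall>x. (if x = w then 1 else 0) = (\<Sum>a\<in>?A. c a * (mon a x :: 'a))"
    by (intro allI delta_expansion)
  from choice[OF this]
  obtain c where c: "\<And>w x. (if x = w then 1 else 0) = (\<Sum>a\<in>?A. c w a * (mon a x :: 'a))"
    by blast
  have fin: "finite ?H" by (rule finite_subset[OF _ finite_bounded_exps]) auto
  obtain h where h: "\<exists>w\<in>W. h w \<noteq> 0" "\<And>a. a \<in> ?H \<Longrightarrow> (\<Sum>w\<in>W. h w * c w a) = 0"
    using exists_nontrivial_solution[OF _ fin assms, of c] by auto
  define f where "f x = (if x \<in> W then h x else 0)" for x
  have "f x = (\<Sum>a\<in>?L. (\<Sum>w\<in>W. h w * c w a) * mon a x)" for x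
  proof -
    have "f x = (\<Sum>w\<in>W. h w * (if x = w then 1 else 0))"
      by (simp add: f_def if_distrib[of "(*) _"] cong: if_cong)
    also have "\<dots> = (\<Sum>w\<in>W. \<Sum>a\<in>?A. h w * c w a * mon a x)"
      unfolding c by (simp add: sum_distrib_left mult.assoc)
    also have "\<dots> = (\<Sum>a\<in>?A. (\<Sum>w\<in>W. h w * c w a) * mon a x)"
      by (subst sum.swap) (simp add: sum_distrib_right)
    also have "\<dots> = (\<Sum>a\<in>?L. (\<Sum>w\<in>W. h w * c w a) * mon a x)"
    proof (rule sum.mono_neutral_right)
      show "\<forall>a\<in>?A - ?L. (\<Sum>w\<in>W. h w * c w a) * mon a x = 0"
      proof
        fix a assume "a \<in> ?A - ?L"
        then have "a \<in> ?H" by (auto simp: exps_def)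
        then show "(\<Sum>w\<in>W. h w * c w a) * mon a x = 0" by (simp add: h(2))
      qed
    qed (auto simp: finite_bounded_exps exps_def)
    finally show ?thesis .
  qed
  then have "low_degree (CARD('a) - 1) D f" unfolding low_degree_def by (intro exI allI)
  moreover have "\<exists>x. f x \<noteq> 0" "\<forall>x. x \<notin> W \<longrightarrow> f x = 0" using h(1) by (auto simp: f_def)
  ultimately show ?thesis by blast
qed

text \<open>The complement \<open>a \<mapsto> m - a\<close> turns degree above \<open>D\<close> into
  degree at most \<open>m * CARD('n) - D - 1\<close>.\<close>

lemma card_high_exps_le:
  assumes "m * CARD('n) \<le> D + e + 1"
  shows "card {a :: nat ^ 'n::finite. (\<forall>i. a $ i \<le> m) \<and> D < (\<Sum>i\<in>UNIV. a $ i)}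
    \<le> card (exps m e :: (nat ^ 'n) set)"
proof (rule card_inj_on_le)
  let ?H = "{a :: nat ^ 'n. (\<forall>i. a $ i \<le> m) \<and> D < (\<Sum>i\<in>UNIV. a $ i)}"
  let ?r = "\<lambda>a :: nat ^ 'n. \<chi> i. m - a $ i"
  show "inj_on ?r ?H"
    by (rule inj_on_inverseI[of _ ?r]) (auto simp: vec_eq_iff)
  show "?r ` ?H \<subseteq> exps m e"
  proof clarify
    fix a :: "nat ^ 'n" assume a: "\<forall>i. a $ i \<le> m" "D < (\<Sum>i\<in>UNIV. a $ i)"
    have "(\<Sum>i\<in>UNIV. a $ i) + (\<Sum>i\<in>UNIV. ?r a $ i) = (\<Sum>i\<in>(UNIV :: 'n set). m)"
      using a(1) by (simp flip: sum.distrib del: sum_constant)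
    then have "(\<Sum>i\<in>UNIV. ?r a $ i) \<le> e" using a(2) assms by (simp add: mult.commute)
    then show "?r a \<in> exps m e" by (simp add: exps_def)
  qed
qed simp

text \<open>Degrees are integers, so the real threshold may be rounded down.\<close>

lemma sumset_bound_eq:
  "sumset_bound TYPE('a::{field,finite} ^ 'n::finite) =
     3 * card (exps (CARD('a) - 1) ((CARD('a) - 1) * CARD('n) div 3) :: (nat ^ 'n) set)"
proof -
  have "real k \<le> (real CARD('a) - 1) * real CARD('n) / 3 \<longleftrightarrow> k \<le> (CARD('a) - 1) * CARD('n) div 3" for k
  proof -
    have "(real CARD('a) - 1) * real CARD('n) = real ((CARD('a) - 1) * CARD('n))"
      by (simp add: of_nat_diff Suc_leI)
    then have "real k \<le> (real CARD('a) - 1) * real CARD('n) / 3 \<longleftrightarrow>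
        real (3 * k) \<le> real ((CARD('a) - 1) * CARD('n))" by (simp add: field_simps)
    also have "\<dots> \<longleftrightarrow> 3 * k \<le> (CARD('a) - 1) * CARD('n)" by (rule of_nat_le_iff)
    finally show ?thesis by (simp add: less_eq_div_iff_mult_less_eq mult.commute)
  qed
  then show ?thesis by (simp only: sumset_bound_def num_monomials_def exps_def)
qed

section \<open>Sumsets\<close>

text \<open>For injective \<open>\<rho>\<close> and \<open>\<kappa>\<close> this is the
  lexicographically first nonzero position. Rows before \<open>s\<close> vanish on all of
  \<open>T\<close>, so adding the matrix to others leaves those rows unchanged.\<close>

definition leading :: "('r \<Rightarrow> nat) \<Rightarrow> ('c \<Rightarrow> nat) \<Rightarrow> 'r set \<Rightarrow> 'c set \<Rightarrow> ('r \<Rightarrow> 'c \<Rightarrow> 'a::zero) \<Rightarrow> 'r \<Rightarrow> 'c \<Rightarrow> bool" where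
  "leading \<rho> \<kappa> S T B s t \<longleftrightarrow> s \<in> S \<and> t \<in> T \<and> B s t \<noteq> 0 \<and>
     (\<forall>s'\<in>S. \<forall>t'\<in>T. \<rho> s' < \<rho> s \<longrightarrow> B s' t' = 0) \<and> (\<forall>t'\<in>T. \<kappa> t' < \<kappa> t \<longrightarrow> B s t' = 0)"

lemma leading_exists:
  assumes "s \<in> S" "t \<in> T" "B s t \<noteq> 0"
  shows "\<exists>s t. leading \<rho> \<kappa> S T B s t"
proof -
  obtain s where s: "s \<in> S" "\<exists>t\<in>T. B s t \<noteq> 0"
      "\<And>s'. s' \<in> S \<and> (\<exists>t\<in>T. B s' t \<noteq> 0) \<Longrightarrow> \<rho> s \<le> \<rho> s'"
    using ex_has_least_nat[of "\<lambda>s. s \<in> S \<and> (\<exists>t\<in>T. B s t \<noteq> 0)" s \<rho>] assms by blast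
  then obtain t0 where "t0 \<in> T \<and> B s t0 \<noteq> 0" by blast
  then obtain t where "t \<in> T" "B s t \<noteq> 0" "\<And>t'. t' \<in> T \<and> B s t' \<noteq> 0 \<Longrightarrow> \<kappa> t \<le> \<kappa> t'"
    using ex_has_least_nat[of "\<lambda>t. t \<in> T \<and> B s t \<noteq> 0" t0 \<kappa>] by blast
  with s have "leading \<rho> \<kappa> S T B s t" unfolding leading_def by (meson not_le)
  then show ?thesis by blast
qed

theorem theorem1:
  fixes S T :: "('a::{field,finite} ^ 'n::finite) set"
  shows "\<exists>S' T'. S' \<subseteq> S \<and> T' \<subseteq> T \<and>
           card S' + card T' \<le> sumset_bound TYPE('a ^ 'n) \<and>
           (S' + T) \<union> (S + T') = S + T"
proof -
  define m where "m = CARD('a) - 1"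
  \<comment> \<open>The thresholds are one third and two thirds of the maximal degree, rounded down.
    The inequalities \<open>De\<close> serve the splitting and the count of high exponents; both
    survive the rounding because of the \<open>+ 1\<close>.\<close>
  define e where "e = m * CARD('n) div 3"
  define D where "D = 2 * (m * CARD('n)) div 3"
  define Low where "Low = (exps m e :: (nat ^ 'n) set)"
  have De: "D \<le> 2 * e + 1" "m * CARD('n) \<le> D + e + 1" unfolding D_def e_def by presburger+
  \<comment> \<open>An arbitrary numbering of the space, used to order both rows and
    columns.\<close>
  obtain \<rho> :: "'a ^ 'n \<Rightarrow> nat" where \<rho>: "inj \<rho>"
    using finite_imp_inj_to_nat_seg[of "UNIV :: ('a ^ 'n) set"] by auto
  define V where "V = {f :: 'a ^ 'n \<Rightarrow> 'a. low_degree m D f \<and> (\<forall>x. x \<notin> S + T \<longrightarrow> f x = 0)}"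
  define lead where "lead f = leading \<rho> \<rho> S T (\<lambda>s t. f (s + t))" for f :: "'a ^ 'n \<Rightarrow> 'a"
  define E where "E = {(s, t). \<exists>f\<in>V. lead f s t}"
  have E: "E \<subseteq> S \<times> T" unfolding E_def lead_def leading_def by auto

  \<comment> \<open>The rank bound for matchings\<close>
  have matching: "card M \<le> card (Low <+> Low)" if M: "M \<subseteq> E" "inj_on fst M" "inj_on snd M" for M
  proof -
    define I where "I = fst ` M"
    \<comment> \<open>\<open>M\<close> is the graph of \<open>p\<close> on \<open>I\<close>;
      \<open>F s\<close> will be a function whose leading position is
      \<open>(s, p s)\<close>.\<close>
    define p where "p s = snd (the_inv_into M fst s)" for s
    have pM: "(s, p s) \<in> M" if "s \<in> I" for s
      using that the_inv_into_into[OF M(2), of s M] f_the_inv_into_f[OF M(2), of s]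
      unfolding I_def p_def by (metis order_refl prod.collapse)
    then have "\<forall>s\<in>I. \<exists>f\<in>V. lead f s (p s)" using M(1) unfolding E_def by blast
    then obtain F where F: "\<And>s. s \<in> I \<Longrightarrow> F s \<in> V" "\<And>s. s \<in> I \<Longrightarrow> lead (F s) s (p s)" by metis
    have IS: "I \<subseteq> S" using M(1) E unfolding I_def by auto
    have "\<exists>X\<subseteq>I. indep_rows I T (\<lambda>i t. \<Sum>j\<in>X. F j (i + t))"
    proof (rule indep_rows_of_leading_positions[where \<rho> = \<rho> and \<kappa> = \<rho> and p = p])
      show "inj_on p I"
        using pM inj_onD[OF M(3)] by (intro inj_onI) (metis prod.inject snd_conv)
      show "p ` I \<subseteq> T" using pM M(1) E by blast
    qed (use \<rho> IS F(2) in \<open>auto simp: lead_def leading_def intro: inj_on_subset\<close>)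
    then obtain X where X: "X \<subseteq> I" "indep_rows I T (\<lambda>i t. \<Sum>j\<in>X. F j (i + t))" by blast
    \<comment> \<open>The sum stays in the low-degree space, so its matrix splits into
      \<open>card (Low <+> Low)\<close> products although its rows in \<open>I\<close> are
      independent.\<close>
    have "low_degree m D (\<lambda>x. \<Sum>j\<in>X. F j x)"
      using X(1) F(1) unfolding V_def by (intro low_degree_sum) auto
    from low_degree_splitting[OF this De(1)] obtain u v where uv:
      "\<And>s t. (\<Sum>j\<in>X. F j (s + t)) = (\<Sum>l\<in>Low <+> Low. u l s * v l t)" unfolding Low_def by blast
    then have "card I \<le> card (Low <+> Low)"
      using finite_code by (intro indep_rows_card_le[OF _ _ X(2) uv]) (auto simp: Low_def)
    then show ?thesis unfolding I_def using M(2) by (simp add: card_image)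
  qed
  have "finite E" by (rule finite_subset[OF E]) simp
  from koenig[OF this matching] obtain X Y where
    XY: "X \<subseteq> fst ` E" "Y \<subseteq> snd ` E" "card X + card Y \<le> card (Low <+> Low)"
      "E \<subseteq> X \<times> UNIV \<union> UNIV \<times> Y" by blast

  \<comment> \<open>The sums not represented by leading positions\<close>
  define W where "W = (S + T) - (\<lambda>(s, t). s + t) ` E"
  have "card W \<le> card Low"
  proof (rule ccontr)
    assume "\<not> card W \<le> card Low"
    then have "card {a :: nat ^ 'n. (\<forall>i. a $ i \<le> CARD('a) - 1) \<and> D < (\<Sum>i\<in>UNIV. a $ i)} < card W"
      using card_high_exps_le[OF De(2)] unfolding m_def Low_def by linarith
    from exists_low_degree_supported[OF this] obtain f x where
      f: "low_degree m D f" "f x \<noteq> 0" "\<And>x. x \<notin> W \<Longrightarrow> f x = 0" unfolding m_def by blast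
    then have fV: "f \<in> V" unfolding V_def W_def by blast
    have "x \<in> S + T" using f(2,3) unfolding W_def by blast
    then obtain s t where "s \<in> S" "t \<in> T" "f (s + t) \<noteq> 0"
      using f(2) by (auto elim: set_plus_elim)
    then obtain s t where st: "lead f s t"
      using leading_exists[of s S t T "\<lambda>s t. f (s + t)"] unfolding lead_def by blast
    then have "(s, t) \<in> E" using fV unfolding E_def by blast
    then have "s + t \<notin> W" unfolding W_def by force
    then show False using f(3) st unfolding lead_def leading_def by blast
  qed
  have "\<forall>w\<in>W. \<exists>s\<in>S. \<exists>t\<in>T. w = s + t" unfolding W_def by (metis DiffD1 set_plus_elim)
  \<comment> \<open>\<open>\<sigma>\<close> selects one row for each of these sums.\<close>
  then obtain \<sigma> where \<sigma>: "\<And>w. w \<in> W \<Longrightarrow> \<sigma> w \<in> S \<and> (\<exists>t\<in>T. w = \<sigma> w + t)" by metis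
  let ?S = "X \<union> \<sigma> ` W"
  have "fst ` E \<subseteq> S" "snd ` E \<subseteq> T" using E by auto
  then have "X \<subseteq> S" and "Y \<subseteq> T" using order_trans[OF XY(1)] order_trans[OF XY(2)] by simp_all
  moreover have "\<sigma> ` W \<subseteq> S" using \<sigma> by (simp add: image_subset_iff)
  ultimately have sub: "?S \<subseteq> S" "Y \<subseteq> T" by simp_all
  \<comment> \<open>The cover contributes twice \<open>card Low\<close>, and the rows selected by
    \<open>\<sigma>\<close> contribute it once more.\<close>
  have "card ?S + card Y \<le> card X + card (\<sigma> ` W) + card Y" by (simp add: card_Un_le)
  also have "\<dots> \<le> 3 * card Low"
    using XY(3) \<open>card W \<le> card Low\<close> card_image_le[of W \<sigma>]
    by (simp add: card_Plus Low_def)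
  finally have card: "card ?S + card Y \<le> sumset_bound TYPE('a ^ 'n)"
    by (simp add: sumset_bound_eq Low_def m_def e_def)
  have "z \<in> (?S + T) \<union> (S + Y)" if z: "z \<in> S + T" for z
  proof (cases "z \<in> W")
    case True
    then obtain t where "t \<in> T" "z = \<sigma> z + t" using \<sigma> by blast
    moreover have "\<sigma> z \<in> ?S" using True by simp
    ultimately have "z \<in> ?S + T" using set_plus_intro by metis
    then show ?thesis ..
  next
    case False
    then have "z \<in> (\<lambda>(s, t). s + t) ` E" using z unfolding W_def by simp
    then obtain s t where st: "(s, t) \<in> E" "z = s + t" by auto
    then have "s \<in> S" "t \<in> T" using E by auto
    moreover have "s \<in> ?S \<or> t \<in> Y" using st(1) XY(4) by auto
    ultimately show ?thesis unfolding st(2) using set_plus_intro by blast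
  qed
  then have "S + T \<subseteq> (?S + T) \<union> (S + Y)" by (rule subsetI)
  moreover have "(?S + T) \<union> (S + Y) \<subseteq> S + T"
    using set_plus_mono2[OF sub(1) order_refl[of T]] set_plus_mono2[OF order_refl[of S] sub(2)]
    by (rule Un_least)
  ultimately have "(?S + T) \<union> (S + Y) = S + T" by (rule subset_antisym[rotated])
  then show ?thesis by (intro exI[of _ ?S] exI[of _ Y] conjI sub card)
qed

end
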